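(* Let $f=h+\overline{g}$ be a harmonic function in the unit disk $\mathbb{D}$, where $h$ and $g$ are analytic in $\mathbb{D}$, such that its Jacobian satisfies $J_f>0$ in $\mathbb{D}$. If $\Lambda_y((h-g)(\mathbb{D}))=\Lambda_y(f(\mathbb{D}))$, then the following statements are equivalent: (1) $f$ is a 1-1 mapping and $f(\mathbb{D})$ is a union of two non-disjoint domains convex in the direction of the real axis. (2) $h-g$ is a 1-1 analytic mapping and $(h-g)(\mathbb{D})$ is a union of two non-disjoint domains convex in the direction of the real axis.
   Context: $\mathbb{D}=\{z\in\mathbb{C}:|z|<1\}$. A function $f:\mathbb{D}\to\mathbb{C}$ is harmonic if its real and imaginary parts satisfy the Laplace equation; equivalently $f=h+\overline{g}$ with $h,g$ analytic in $\mathbb{D}$. Its Jacobian is $J_f(z)=|h'(z)|^2-|g'(z)|^2$. A domain is a nonempty open connected subset of $\mathbb{C}$; it is convex in the direction of the real axis if its intersection with every horizontal line $\{z\in\mathbb{C}:\Im z=a\}$, $a\in\mathbb{R}$, is connected or empty. "1-1" means injective. For a set $D\subset\mathbb{C}$, $\Lambda_y(D):=\{a\in\mathbb{R}: D\cap\{z\in\mathbb{C}:\Im z=a\}\text{ is a nonempty and connected set}\}$. *)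

theory Defs
  imports "HOL-Complex_Analysis.Complex_Analysis"
begin

abbreviation unit_disk :: "complex set"  ("\<D>")
  where "\<D> \<equiv> ball 0 1"

(* u is of class C^2 on the open set S and u_xx + u_yy = 0 there; the witnesses are
   p = u_x, q = u_y, r = u_xx, s = u_xy = u_yx, t = u_yy. *)
definition satisfies_laplace_on :: "(complex \<Rightarrow> real) \<Rightarrow> complex set \<Rightarrow> bool" where
  "satisfies_laplace_on u S \<longleftrightarrow>
     (\<exists>p q r s t :: complex \<Rightarrow> real.
        (\<forall>z\<in>S. (u has_derivative (\<lambda>w. p z * Re w + q z * Im w)) (at z) \<and>
               (p has_derivative (\<lambda>w. r z * Re w + s z * Im w)) (at z) \<and>
               (q has_derivative (\<lambda>w. s z * Re w + t z * Im w)) (at z) \<and>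
               r z + t z = 0) \<and>
        continuous_on S r \<and> continuous_on S s \<and> continuous_on S t)"

definition harmonic_on :: "(complex \<Rightarrow> complex) \<Rightarrow> complex set \<Rightarrow> bool" where
  "harmonic_on f S \<longleftrightarrow>
     satisfies_laplace_on (\<lambda>z. Re (f z)) S \<and> satisfies_laplace_on (\<lambda>z. Im (f z)) S"

(* the Jacobian of h + cnj g *)
definition harmonic_jacobian :: "(complex \<Rightarrow> complex) \<Rightarrow> (complex \<Rightarrow> complex) \<Rightarrow> complex \<Rightarrow> real" where
  "harmonic_jacobian h g z = (cmod (deriv h z))\<^sup>2 - (cmod (deriv g z))\<^sup>2"

definition complex_domain :: "complex set \<Rightarrow> bool" where
  "complex_domain D \<longleftrightarrow> D \<noteq> {} \<and> open D \<and> connected D"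

definition horizontal_line :: "real \<Rightarrow> complex set" where
  "horizontal_line a = {z. Im z = a}"

(* "connected" holds for the empty set, so empty intersections are allowed here. *)
definition convex_real_direction :: "complex set \<Rightarrow> bool" where
  "convex_real_direction D \<longleftrightarrow> (\<forall>a. connected (D \<inter> horizontal_line a))"

definition Lambda_y :: "complex set \<Rightarrow> real set"  ("\<Lambda>\<^sub>y") where
  "\<Lambda>\<^sub>y D = {a. D \<inter> horizontal_line a \<noteq> {} \<and> connected (D \<inter> horizontal_line a)}"

definition union_of_two_domains_convex_real_direction :: "complex set \<Rightarrow> bool" where
  "union_of_two_domains_convex_real_direction D \<longleftrightarrow>
     (\<exists>A B. complex_domain A \<and> convex_real_direction A \<and> complex_domain B \<and> convex_real_direction B \<and>
            A \<inter> B \<noteq> {} \<and> D = A \<union> B)"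

lemma satisfies_laplace_on_Re_holomorphic:
  assumes F: "F holomorphic_on S" and S: "open S"
  shows "satisfies_laplace_on (\<lambda>z. Re (F z)) S"
proof -
  have F': "deriv F holomorphic_on S" and F'': "deriv (deriv F) holomorphic_on S"
    using F S by (auto intro!: holomorphic_deriv)
  have D: "(G has_derivative (\<lambda>w. deriv G z * w)) (at z)"
    if "G holomorphic_on S" "z \<in> S" for G z
    using holomorphic_derivI[OF that(1) S that(2)] by (simp add: has_field_derivative_def)
  have DRe: "((\<lambda>z. Re (G z)) has_derivative (\<lambda>w. Re (deriv G z) * Re w + (- Im (deriv G z)) * Im w)) (at z)"
    if "G holomorphic_on S" "z \<in> S" for G z
    using has_derivative_Re[OF D[OF that]] by simp
  have DIm: "((\<lambda>z. - Im (G z)) has_derivative (\<lambda>w. (- Im (deriv G z)) * Re w + (- Re (deriv G z)) * Im w)) (at z)"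
    if "G holomorphic_on S" "z \<in> S" for G z
    using has_derivative_minus[OF has_derivative_Im[OF D[OF that]]] by (simp add: algebra_simps)
  have c: "continuous_on S (deriv (deriv F))"
    using F'' by (rule holomorphic_on_imp_continuous_on)
  show ?thesis
    unfolding satisfies_laplace_on_def
    apply (rule exI[of _ "\<lambda>z. Re (deriv F z)"], rule exI[of _ "\<lambda>z. - Im (deriv F z)"],
        rule exI[of _ "\<lambda>z. Re (deriv (deriv F) z)"], rule exI[of _ "\<lambda>z. - Im (deriv (deriv F) z)"],
        rule exI[of _ "\<lambda>z. - Re (deriv (deriv F) z)"])
    using DRe[OF F] DRe[OF F'] DIm[OF F'] c by (auto intro!: continuous_intros)
qed

(* Harmonicity of h + cnj g is automatic. *)
lemma harmonic_on_holomorphic_add_cnj: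
  assumes h: "h holomorphic_on S" and g: "g holomorphic_on S" and S: "open S"
  shows "harmonic_on (\<lambda>z. h z + cnj (g z)) S"
proof -
  have "satisfies_laplace_on (\<lambda>z. Re (h z + g z)) S"
    using assms by (intro satisfies_laplace_on_Re_holomorphic holomorphic_intros)
  moreover have "satisfies_laplace_on (\<lambda>z. Re (- \<i> * (h z - g z))) S"
    using assms by (intro satisfies_laplace_on_Re_holomorphic holomorphic_intros)
  ultimately show ?thesis
    by (simp add: harmonic_on_def)
qed

end

theory Submission
  imports Defs
begin

text \<open>The functions \<open>f = h + cnj g\<close> and \<open>\<phi> = h - g\<close> have the same imaginary part, so when one of them is
  injective, the other one is obtained by composing it with a map \<open>T\<close> of its image that preserves
  every horizontal line. The condition \<open>|h'| > |g'|\<close> makes \<open>T\<close> strictly increasing on every horizontal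
  segment, hence injective wherever the line meets the image in a connected set. On a line that meets
  the image in two disjoint intervals, two points with equal images under \<open>T\<close> would make the
  image of the line connected, which the equality of the sets \<open>\<Lambda>\<^sub>y\<close> excludes.\<close>

section \<open>Line-preserving maps that increase along horizontal segments\<close>

text \<open>Only segments lying entirely in \<open>U\<close> count: a derivative condition gives no
  comparison across a gap of \<open>U\<close> on a line.\<close>

definition increasing_on_horizontal_segments :: "(complex \<Rightarrow> complex) \<Rightarrow> complex set \<Rightarrow> bool" where
  "increasing_on_horizontal_segments T U \<longleftrightarrow>
     (\<forall>a x y. x < y \<longrightarrow> (\<forall>t\<in>{x..y}. Complex t a \<in> U) \<longrightarrow> Re (T (Complex x a)) < Re (T (Complex y a)))"

lemma connected_horizontal_contains_segment:
  assumes "connected (U \<inter> horizontal_line a)" "u \<in> U" "v \<in> U" "Im u = a" "Im v = a"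
    and t: "t \<in> {Re u..Re v}"
  shows "Complex t a \<in> U"
proof -
  have "connected (Re ` (U \<inter> horizontal_line a))"
    using assms(1) by (intro connected_continuous_image continuous_intros)
  moreover have "Re u \<in> Re ` (U \<inter> horizontal_line a)" "Re v \<in> Re ` (U \<inter> horizontal_line a)"
    using assms by (auto simp: horizontal_line_def)
  ultimately have "t \<in> Re ` (U \<inter> horizontal_line a)"
    using connected_contains_Icc t by blast
  then obtain z where "z \<in> U" "Im z = a" "t = Re z"
    by (auto simp: horizontal_line_def)
  then show ?thesis by auto
qed

text \<open>A connected slice contains the segment between any two of its points, so
  \<open>T\<close> is strictly increasing along it. Monotonicity is inherited from \<open>U\<close>,
  while connectedness is asked of the slice of the subset \<open>V\<close>.\<close>

lemma inj_on_horizontal_slice: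
  assumes T: "increasing_on_horizontal_segments T U" and "V \<subseteq> U"
    and conn: "connected (V \<inter> horizontal_line a)"
  shows "inj_on T (V \<inter> horizontal_line a)"
proof -
  have less: "Re (T u) < Re (T v)"
    if "u \<in> V \<inter> horizontal_line a" "v \<in> V \<inter> horizontal_line a" "Re u < Re v" for u v
  proof -
    have im: "Im u = a" "Im v = a"
      using that by (auto simp: horizontal_line_def)
    have "\<forall>t\<in>{Re u..Re v}. Complex t a \<in> U"
      using connected_horizontal_contains_segment[OF conn] that im \<open>V \<subseteq> U\<close> by blast
    with T that(3) have "Re (T (Complex (Re u) a)) < Re (T (Complex (Re v) a))"
      unfolding increasing_on_horizontal_segments_def by blast
    then show ?thesis
      using im by (metis complex_surj)
  qed
  show ?thesis
  proof (rule inj_onI)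
    fix u v assume uv: "u \<in> V \<inter> horizontal_line a" "v \<in> V \<inter> horizontal_line a" "T u = T v"
    then have "Re u = Re v"
      using less[of u v] less[of v u] by (metis less_irrefl linorder_neqE_linordered_idom)
    with uv show "u = v"
      by (auto simp: horizontal_line_def complex_eq_iff)
  qed
qed

lemma image_Int_horizontal_line:
  assumes "\<And>w. w \<in> V \<Longrightarrow> Im (T w) = Im w"
  shows "T ` V \<inter> horizontal_line a = T ` (V \<inter> horizontal_line a)"
  using assms by (auto simp: horizontal_line_def)

text \<open>Within \<open>A\<close> or within \<open>B\<close> the slices are connected and
  monotonicity suffices. The remaining case, a point of \<open>A\<close> against a point of
  \<open>B\<close>, is where \<open>lam\<close> enters.\<close>

lemma Im_preserving_inj_on_Un:
  assumes A: "convex_real_direction A" and B: "convex_real_direction B"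
    and cont: "continuous_on (A \<union> B) T"
    and im: "\<And>w. w \<in> A \<union> B \<Longrightarrow> Im (T w) = Im w"
    and inc: "increasing_on_horizontal_segments T (A \<union> B)"
    and lam: "\<Lambda>\<^sub>y (T ` (A \<union> B)) \<subseteq> \<Lambda>\<^sub>y (A \<union> B)"
  shows "inj_on T (A \<union> B)"
proof -
  have slice: "connected (T ` V \<inter> horizontal_line a)"
    if "convex_real_direction V" "V \<subseteq> A \<union> B" for V a
  proof -
    have "connected (T ` (V \<inter> horizontal_line a))"
      using that
      by (intro connected_continuous_image continuous_on_subset[OF cont])
        (auto simp: convex_real_direction_def)
    then show ?thesis
      using that im by (subst image_Int_horizontal_line) auto
  qed
  \<comment> \<open>\<open>V\<close> is kept general: it will be \<open>A\<close>, \<open>B\<close>,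
    and, once its slice is known to be connected, all of \<open>A \<union> B\<close>.\<close>
  have one: "u = v" if "V \<subseteq> A \<union> B" "connected (V \<inter> horizontal_line (Im u))"
    "u \<in> V" "v \<in> V" "T u = T v" for u v V
  proof -
    have "Im u = Im v"
      using that im by (metis subsetD)
    then show ?thesis
      using inj_on_horizontal_slice[OF inc that(1,2)] that(3-5)
      by (auto simp: horizontal_line_def dest: inj_onD)
  qed
  have two: "u = v" if uv: "u \<in> A" "v \<in> B" "T u = T v" for u v
  proof -
    let ?L = "horizontal_line (Im u)"
    have "T u \<in> ?L"
      using uv(1) im by (simp add: horizontal_line_def)
    moreover have "T u \<in> T ` A" "T u \<in> T ` B"
      using uv by (metis imageI)+
    ultimately have L: "T u \<in> T ` A \<inter> ?L" "T u \<in> T ` B \<inter> ?L"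
      by blast+
    \<comment> \<open>The common value \<open>T u = T v\<close> lies in both image slices, so their
      union is connected. By \<open>lam\<close> the slice of \<open>A \<union> B\<close> itself is
      then connected.\<close>
    have "connected ((T ` A \<inter> ?L) \<union> (T ` B \<inter> ?L))"
      using A B L by (intro connected_Un slice) auto
    then have "connected (T ` (A \<union> B) \<inter> ?L)"
      by (simp add: image_Un Int_Un_distrib2)
    with L have "Im u \<in> \<Lambda>\<^sub>y (T ` (A \<union> B))"
      unfolding Lambda_y_def by auto
    with lam have "connected ((A \<union> B) \<inter> ?L)"
      unfolding Lambda_y_def by auto
    then show ?thesis
      using one[OF subset_refl, of u v] uv by blast
  qed
  show ?thesis
  proof (rule inj_onI)
    fix u v assume uv: "u \<in> A \<union> B" "v \<in> A \<union> B" "T u = T v"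
    have same: "connected (V \<inter> horizontal_line a)" if "V = A \<or> V = B" for V a
      using that A B unfolding convex_real_direction_def by blast
    from uv consider "u \<in> A" "v \<in> A" | "u \<in> B" "v \<in> B" | "u \<in> A" "v \<in> B" | "u \<in> B" "v \<in> A"
      by blast
    then show "u = v"
    proof cases
      case 1
      then show ?thesis using one[of A u v] same uv(3) by blast
    next
      case 2
      then show ?thesis using one[of B u v] same uv(3) by blast
    next
      case 3
      then show ?thesis using two uv(3) by blast
    next
      case 4
      then show ?thesis using two[OF _ _ uv(3)[symmetric]] by simp
    qed
  qed
qed

text \<open>Openness of the image is invariance of domain; the slices of the image are the images of
  the slices.\<close>

lemma Im_preserving_image_domain:
  assumes V: "complex_domain V" "convex_real_direction V"
    and cont: "continuous_on V T" and inj: "inj_on T V"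
    and im: "\<And>w. w \<in> V \<Longrightarrow> Im (T w) = Im w"
  shows "complex_domain (T ` V)" "convex_real_direction (T ` V)"
proof -
  show "complex_domain (T ` V)"
    using V cont inj unfolding complex_domain_def
    by (auto intro: invariance_of_domain connected_continuous_image)
  have "connected (T ` (V \<inter> horizontal_line a))" for a
    using V
    by (intro connected_continuous_image continuous_on_subset[OF cont])
      (auto simp: convex_real_direction_def)
  then show "convex_real_direction (T ` V)"
    unfolding convex_real_direction_def using im by (simp add: image_Int_horizontal_line)
qed

lemma Im_preserving_union_of_two_domains:
  assumes U: "union_of_two_domains_convex_real_direction U"
    and cont: "continuous_on U T"
    and im: "\<And>w. w \<in> U \<Longrightarrow> Im (T w) = Im w"
    and inc: "increasing_on_horizontal_segments T U"
    and lam: "\<Lambda>\<^sub>y (T ` U) \<subseteq> \<Lambda>\<^sub>y U"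
  shows "inj_on T U \<and> union_of_two_domains_convex_real_direction (T ` U)"
proof -
  obtain A B where AB: "complex_domain A" "convex_real_direction A"
    "complex_domain B" "convex_real_direction B" "A \<inter> B \<noteq> {}" "U = A \<union> B"
    using U unfolding union_of_two_domains_convex_real_direction_def by blast
  have inj: "inj_on T U"
    using Im_preserving_inj_on_Un[OF AB(2,4)] cont im inc lam unfolding AB(6) by blast
  have "complex_domain (T ` V)" "convex_real_direction (T ` V)"
    if "V \<subseteq> U" "complex_domain V" "convex_real_direction V" for V
    using Im_preserving_image_domain[OF that(2,3) continuous_on_subset[OF cont that(1)]
        inj_on_subset[OF inj that(1)]] im that(1) by blast+
  with AB have "complex_domain (T ` A)" "convex_real_direction (T ` A)"
    "complex_domain (T ` B)" "convex_real_direction (T ` B)"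
    by auto
  moreover have "T ` A \<inter> T ` B \<noteq> {}" "T ` U = T ` A \<union> T ` B"
    using AB(5,6) by auto
  ultimately show ?thesis
    using inj unfolding union_of_two_domains_convex_real_direction_def by blast
qed

text \<open>\<open>T' 1\<close> is the derivative in the direction of the real axis. The derivative
  is only real linear, since \<open>T\<close> need not be holomorphic.\<close>

lemma increasing_on_horizontal_segmentsI:
  assumes deriv: "\<And>w. w \<in> U \<Longrightarrow> \<exists>T'. (T has_derivative T') (at w) \<and> Re (T' 1) > 0"
  shows "increasing_on_horizontal_segments T U"
  unfolding increasing_on_horizontal_segments_def
proof (intro allI impI)
  fix a x y :: real
  assume "x < y" and U: "\<forall>t\<in>{x..y}. Complex t a \<in> U"
  show "Re (T (Complex x a)) < Re (T (Complex y a))"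
  proof (rule DERIV_pos_imp_increasing[OF \<open>x < y\<close>])
    fix t assume "x \<le> t" "t \<le> y"
    with U deriv obtain T' where T': "(T has_derivative T') (at (Complex t a))" "Re (T' 1) > 0"
      by (metis atLeastAtMost_iff)
    have line: "((\<lambda>t. Complex t a) has_derivative (\<lambda>s. of_real s)) (at t)"
      unfolding Complex_eq by (auto intro!: derivative_eq_intros)
    have "((\<lambda>t. Re (T (Complex t a))) has_derivative (\<lambda>s. Re (T' (of_real s)))) (at t)"
      using has_derivative_Re[OF has_derivative_compose[OF line T'(1)]] .
    moreover have "Re (T' (of_real s)) = Re (T' 1) * s" for s
      using linear_scale[OF has_derivative_linear[OF T'(1)], of s 1] by (simp add: scaleR_conv_of_real)
    ultimately have "((\<lambda>t. Re (T (Complex t a))) has_real_derivative Re (T' 1)) (at t)"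
      by (simp add: has_field_derivative_def)
    with T'(2) show "\<exists>d. ((\<lambda>t. Re (T (Complex t a))) has_real_derivative d) (at t) \<and> 0 < d"
      by blast
  qed
qed

section \<open>Passing from one map to another with the same imaginary part\<close>

text \<open>Applies the preceding results to \<open>T = Q \<circ> inv_into S P\<close>. Here
  \<open>R\<close> inverts \<open>P'\<close>, so \<open>Q' \<circ> R\<close> is the derivative of
  \<open>T\<close> and the positivity condition is its monotonicity. With \<open>P\<close> and
  \<open>Q\<close> arbitrary, the lemma serves both implications.\<close>

lemma shear_union_of_two_domains:
  fixes P Q :: "complex \<Rightarrow> complex"
  assumes S: "open S"
    and im: "\<And>z. z \<in> S \<Longrightarrow> Im (Q z) = Im (P z)"
    and deriv: "\<And>z. z \<in> S \<Longrightarrow> \<exists>P' Q' R. (P has_derivative P') (at z) \<and> (Q has_derivative Q') (at z) \<and>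
                  P' \<circ> R = id \<and> Re (Q' (R 1)) > 0"
    and lam: "\<Lambda>\<^sub>y (Q ` S) \<subseteq> \<Lambda>\<^sub>y (P ` S)"
    and inj: "inj_on P S" and un: "union_of_two_domains_convex_real_direction (P ` S)"
  shows "inj_on Q S \<and> union_of_two_domains_convex_real_direction (Q ` S)"
proof -
  define T where "T = Q \<circ> inv_into S P"
  have TP: "T (P z) = Q z" if "z \<in> S" for z
    using that inj by (simp add: T_def)
  then have img: "T ` P ` S = Q ` S"
    by (simp add: image_image)
  have contP: "continuous_on S P"
    using deriv has_derivative_continuous continuous_at_imp_continuous_on by blast
  have T': "\<exists>T'. (T has_derivative T') (at w) \<and> Re (T' 1) > 0" if "w \<in> P ` S" for w
  proof -
    obtain z where z: "w = P z" "z \<in> S"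
      using \<open>w \<in> P ` S\<close> by (rule imageE)
    obtain P' Q' R where PQR: "(P has_derivative P') (at z)" "(Q has_derivative Q') (at z)"
      "P' \<circ> R = id" "Re (Q' (R 1)) > 0"
      using deriv[OF z(2)] by blast
    \<comment> \<open>Inverse function theorem: injectivity makes \<open>inv_into S P\<close> a left
      inverse of \<open>P\<close> on the open set \<open>S\<close>.\<close>
    have "(inv_into S P has_derivative R) (at (P z))"
      using has_derivative_inverse_strong[OF S z(2) contP _ PQR(1,3)] inj by auto
    moreover have "(Q has_derivative Q') (at (inv_into S P (P z)))"
      using PQR(2) z(2) inj by simp
    ultimately have "(T has_derivative (Q' \<circ> R)) (at w)"
      unfolding T_def z(1) by (rule diff_chain_at)
    with PQR(4) show ?thesis
      by auto
  qed
  have "continuous_on (P ` S) T"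
    by (meson T' has_derivative_continuous continuous_at_imp_continuous_on)
  moreover have "Im (T w) = Im w" if "w \<in> P ` S" for w
    using that TP im by auto
  moreover have "increasing_on_horizontal_segments T (P ` S)"
    using T' by (rule increasing_on_horizontal_segmentsI)
  moreover have "\<Lambda>\<^sub>y (T ` P ` S) \<subseteq> \<Lambda>\<^sub>y (P ` S)"
    unfolding img by (rule lam)
  ultimately have "inj_on T (P ` S) \<and> union_of_two_domains_convex_real_direction (T ` P ` S)"
    by (rule Im_preserving_union_of_two_domains[OF un])
  then have T: "inj_on T (P ` S)" "union_of_two_domains_convex_real_direction (Q ` S)"
    unfolding img by simp_all
  have "inj_on (T \<circ> P) S"
    using inj T(1) by (rule comp_inj_on)
  then have "inj_on Q S"
    using TP by (simp add: inj_on_def)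
  with T(2) show ?thesis by blast
qed

section \<open>Derivatives of \<open>f\<close> and \<open>h - g\<close>, and the two
  implications\<close>

theorem theorem3p2:
  fixes f h g :: "complex \<Rightarrow> complex"
  assumes harm: "harmonic_on f \<D>"
    and h: "h holomorphic_on \<D>"
    and g: "g holomorphic_on \<D>"
    and f: "\<forall>z\<in>\<D>. f z = h z + cnj (g z)"
    and jac: "\<forall>z\<in>\<D>. harmonic_jacobian h g z > 0"
    and lam: "\<Lambda>\<^sub>y ((\<lambda>z. h z - g z) ` \<D>) = \<Lambda>\<^sub>y (f ` \<D>)"
  shows "(inj_on f \<D> \<and> union_of_two_domains_convex_real_direction (f ` \<D>)) \<longleftrightarrow>
         (inj_on (\<lambda>z. h z - g z) \<D> \<and> (\<lambda>z. h z - g z) holomorphic_on \<D> \<and>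
          union_of_two_domains_convex_real_direction ((\<lambda>z. h z - g z) ` \<D>))"
proof -
  let ?\<phi> = "\<lambda>z. h z - g z"
  have im: "Im (f z) = Im (?\<phi> z)" if "z \<in> \<D>" for z
    using f that by simp
  define F' where "F' z v = deriv h z * v + cnj (deriv g z * v)" for z v
  define \<Phi>' where "\<Phi>' z v = (deriv h z - deriv g z) * v" for z v
  define J where "J z = complex_of_real (harmonic_jacobian h g z)" for z
  \<comment> \<open>With \<open>a = deriv h z\<close> and \<open>b = deriv g z\<close>, this is the
    solution \<open>v\<close> of \<open>a * v + cnj (b * v) = w\<close>, found by eliminating
    \<open>cnj v\<close> between the equation and its conjugate; the determinant is
    \<open>J z\<close>.\<close>
  define RF where "RF z w = (cnj (deriv h z) * w - cnj (deriv g z) * cnj w) / J z" for z w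
  define R\<Phi> where "R\<Phi> z w = w / (deriv h z - deriv g z)" for z w
  have F': "(f has_derivative F' z) (at z)" and \<Phi>': "(?\<phi> has_derivative \<Phi>' z) (at z)"
    if "z \<in> \<D>" for z
  proof -
    have dh: "(h has_derivative (*) (deriv h z)) (at z)" and dg: "(g has_derivative (*) (deriv g z)) (at z)"
      using holomorphic_derivI[OF h _ that] holomorphic_derivI[OF g _ that]
      by (auto simp: has_field_derivative_def)
    have "((\<lambda>z. h z + cnj (g z)) has_derivative F' z) (at z)"
      unfolding F'_def by (intro has_derivative_add dh has_derivative_cnj dg)
    then show "(f has_derivative F' z) (at z)"
      by (rule has_derivative_transform_within_open[of _ _ _ _ \<D>]) (use f that in auto)
    show "(?\<phi> has_derivative \<Phi>' z) (at z)"
      using has_derivative_diff[OF dh dg] by (simp add: \<Phi>'_def[abs_def] algebra_simps)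
  qed
  have J: "J z = deriv h z * cnj (deriv h z) - deriv g z * cnj (deriv g z)" for z
    unfolding J_def harmonic_jacobian_def of_real_diff complex_norm_square ..
  \<comment> \<open>Equal derivatives would have equal moduli and make the Jacobian zero.\<close>
  have J0: "J z \<noteq> 0" "deriv h z \<noteq> deriv g z" if "z \<in> \<D>" for z
  proof -
    have "harmonic_jacobian h g z > 0"
      using jac that by blast
    then show "J z \<noteq> 0" "deriv h z \<noteq> deriv g z"
      unfolding J_def by (simp, auto simp: harmonic_jacobian_def)
  qed
  have cnjJ: "cnj (J z) = J z" for z
    by (simp add: J_def)
  have RF: "F' z \<circ> RF z = id" if "z \<in> \<D>" for z
  proof
    fix w
    let ?a = "deriv h z" and ?b = "deriv g z"
    have "F' z (RF z w) = (?a * (cnj ?a * w - cnj ?b * cnj w) + cnj ?b * (?a * cnj w - ?b * w)) / J z"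
      unfolding F'_def RF_def by (simp add: cnjJ flip: add_divide_distrib)
    also have "?a * (cnj ?a * w - cnj ?b * cnj w) + cnj ?b * (?a * cnj w - ?b * w) = J z * w"
      unfolding J by (simp add: algebra_simps)
    finally have "F' z (RF z w) = J z * w / J z" .
    then show "(F' z \<circ> RF z) w = id w"
      using J0[OF that] by simp
  qed
  have R\<Phi>: "\<Phi>' z \<circ> R\<Phi> z = id" if "z \<in> \<D>" for z
    using J0[OF that] by (auto simp: \<Phi>'_def R\<Phi>_def)
  have pos\<Phi>: "Re (\<Phi>' z (RF z 1)) > 0" if "z \<in> \<D>" for z
  proof -
    \<comment> \<open>\<open>RF z 1\<close> is \<open>cnj (deriv h z - deriv g z) / J z\<close>, so
      the product with \<open>deriv h z - deriv g z\<close> is a squared modulus over the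
      Jacobian.\<close>
    have "\<Phi>' z (RF z 1) = of_real ((cmod (deriv h z - deriv g z))\<^sup>2 / harmonic_jacobian h g z)"
      unfolding \<Phi>'_def RF_def of_real_divide complex_norm_square J_def by simp
    then show ?thesis
      using jac J0[OF that] that by simp
  qed
  have posF: "Re (F' z (R\<Phi> z 1)) > 0" if "z \<in> \<D>" for z
  proof -
    let ?a = "deriv h z" and ?b = "deriv g z"
    have "Re (F' z (R\<Phi> z 1)) = Re (?a / (?a - ?b)) + Re (cnj (?b / (?a - ?b)))"
      by (simp add: F'_def R\<Phi>_def)
    \<comment> \<open>Conjugation does not change the real part, so the two quotients combine.
      Multiplying by the conjugate denominator then brings out the Jacobian.\<close>
    also have "\<dots> = Re ((?a + ?b) / (?a - ?b))"
      by (simp only: cnj.sel add_divide_distrib plus_complex.sel)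
    also have "\<dots> = Re ((?a + ?b) * cnj (?a - ?b)) / (cmod (?a - ?b))\<^sup>2"
      by (simp only: complex_div_cnj[of "?a + ?b"] of_real_power[symmetric] Re_divide_of_real)
    also have "Re ((?a + ?b) * cnj (?a - ?b)) = harmonic_jacobian h g z"
      unfolding harmonic_jacobian_def cmod_power2 by (simp add: algebra_simps power2_eq_square)
    finally show ?thesis
      using jac J0[OF that] that by simp
  qed
  \<comment> \<open>Each implication uses one of the two inclusions contained in
    \<open>lam\<close>.\<close>
  have "inj_on ?\<phi> \<D> \<and> union_of_two_domains_convex_real_direction (?\<phi> ` \<D>)"
    if "inj_on f \<D>" "union_of_two_domains_convex_real_direction (f ` \<D>)"
  proof (rule shear_union_of_two_domains[OF open_ball _ _ _ that])
    show "\<exists>P' Q' R. (f has_derivative P') (at z) \<and> (?\<phi> has_derivative Q') (at z) \<and>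
            P' \<circ> R = id \<and> Re (Q' (R 1)) > 0" if "z \<in> \<D>" for z
      using F'[OF that] \<Phi>'[OF that] RF[OF that] pos\<Phi>[OF that] by blast
  qed (use im lam in simp_all)
  moreover have "inj_on f \<D> \<and> union_of_two_domains_convex_real_direction (f ` \<D>)"
    if "inj_on ?\<phi> \<D>" "union_of_two_domains_convex_real_direction (?\<phi> ` \<D>)"
  proof (rule shear_union_of_two_domains[OF open_ball _ _ _ that])
    show "\<exists>P' Q' R. (?\<phi> has_derivative P') (at z) \<and> (f has_derivative Q') (at z) \<and>
            P' \<circ> R = id \<and> Re (Q' (R 1)) > 0" if "z \<in> \<D>" for z
      using F'[OF that] \<Phi>'[OF that] R\<Phi>[OF that] posF[OF that] by blast
  qed (use im lam in simp_all)
  moreover have "?\<phi> holomorphic_on \<D>"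
    using h g by (intro holomorphic_intros)
  ultimately show ?thesis
    by blast
qed

end
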